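(* Let $m$ be an even positive integer and let $p$ be an odd prime. Then the generalized Euler polynomial $E_{mp}^{(mp)}(x)\in\mathbb{Q}[x]$ is in Eisenstein form with respect to $p$ if and only if $p$ does not divide the integer $m(2^m-1)B_m$.
   Context: For a positive integer $m$ and an integer $n\ge 0$, the $m$th order Euler polynomial of degree $n$, denoted $E_n^{(m)}(x)\in\mathbb{Q}[x]$, is defined by the identity of formal power series in $t$ $$\left(\frac{2}{e^t+1}\right)^m e^{tx}=\sum_{n=0}^{\infty}E_n^{(m)}(x)\frac{t^n}{n!}.$$ The Bernoulli numbers $B_n$ are defined by $\frac{t}{e^t-1}=\sum_{n=0}^\infty B_n\frac{t^n}{n!}$. For even $m\geq 2$ the number $m(2^m-1)B_m$ is an integer. For a prime $p$, $\nu_p$ denotes the $p$-adic valuation on $\mathbb{Q}$ (with $\nu_p(0)=+\infty$). A polynomial $f(x)=\sum_{j=0}^n a_jx^j\in\mathbb{Q}[x]$ of degree $n$ is in Eisenstein form with respect to $p$ if $\nu_p(a_n)=0$, $\nu_p(a_j)\ge 1$ for all $j\in\{0,1,\ldots,n-1\}$, and $\nu_p(a_0)=1$. *)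

theory Defs
  imports
    "HOL-Computational_Algebra.Computational_Algebra"
    "HOL-Library.Extended"
begin

text \<open>
  The generating identity lives in the ring of power series in \<open>t\<close> over the polynomials in \<open>x\<close>:
  the coefficients of the series in \<open>t\<close> alone are embedded as constant polynomials, and the
  coefficient of \<open>e\<^sup>t\<^sup>x\<close> at \<open>t^k\<close> is \<open>x^k / k!\<close>.
\<close>

definition exp_tx :: "rat poly fps" where
  "exp_tx = Abs_fps (\<lambda>k. monom (1 / fact k) k)"

definition const_coeffs :: "rat fps \<Rightarrow> rat poly fps" where
  "const_coeffs F = Abs_fps (\<lambda>k. [:fps_nth F k:])"

definition euler_poly :: "nat \<Rightarrow> nat \<Rightarrow> rat poly" where
  "euler_poly m n =
     smult (fact n) (fps_nth (const_coeffs ((2 / (fps_exp 1 + 1)) ^ m) * exp_tx) n)"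

lemma euler_poly_generating_function:
  "const_coeffs ((2 / (fps_exp 1 + 1)) ^ m) * exp_tx
     = Abs_fps (\<lambda>n. smult (1 / fact n) (euler_poly m n))"
  by (simp add: fps_eq_iff euler_poly_def)

definition bernoulli :: "nat \<Rightarrow> rat" where
  "bernoulli n = fact n * fps_nth (fps_X / (fps_exp 1 - 1)) n"

lemma bernoulli_generating_function:
  "fps_X / (fps_exp 1 - 1) = Abs_fps (\<lambda>n. bernoulli n / fact n)"
  by (simp add: fps_eq_iff bernoulli_def)

text \<open>The division by \<open>e^t - 1\<close>, which is not a unit, is exact.\<close>

lemma bernoulli_quotient_exact:
  "fps_X / (fps_exp 1 - 1) * (fps_exp 1 - 1) = (fps_X :: rat fps)"
proof -
  have nz: "fps_exp 1 - 1 \<noteq> (0 :: rat fps)"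
    by (auto simp: fps_eq_iff intro!: exI[of _ 1])
  have "subdegree (fps_exp 1 - 1 :: rat fps) = 1"
    by (rule subdegreeI) auto
  then have "(fps_exp 1 - 1 :: rat fps) dvd fps_X"
    using nz by (simp add: fps_dvd_iff)
  then show ?thesis by simp
qed

text \<open>
  The valuation takes values in the integers extended by \<open>\<infinity>\<close>; the constructor \<open>Fin\<close> embeds
  the integers (the value \<open>-\<infinity>\<close> of the type is not attained).
\<close>

definition padic_val :: "nat \<Rightarrow> rat \<Rightarrow> int extended" where
  "padic_val p x =
     (if x = 0 then \<infinity>
      else Fin (int (multiplicity (int p) (fst (quotient_of x)))
              - int (multiplicity (int p) (snd (quotient_of x)))))"

definition eisenstein_form :: "nat \<Rightarrow> rat poly \<Rightarrow> bool" where
  "eisenstein_form p f \<longleftrightarrow>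
     padic_val p (coeff f (degree f)) = 0 \<and>
     (\<forall>j<degree f. padic_val p (coeff f j) \<ge> 1) \<and>
     padic_val p (coeff f 0) = 1"

end

theory Submission
  imports "HOL-Number_Theory.Residues" Defs
begin

text \<open>
  Write \<open>G = 2 / (e\<^sup>t + 1)\<close>, with Euler numbers \<open>E\<^sub>n\<close> given by \<open>G = \<Sum> E\<^sub>n t^n / n!\<close>, and let
  \<open>\<epsilon>\<^sub>n\<close> be the coefficient of \<open>t^n / n!\<close> in \<open>G^(m p)\<close>.  The Euler polynomial of order \<open>m p\<close>
  and degree \<open>n\<close> has coefficient \<open>(n choose j) \<epsilon>\<^sub>n\<^sub>-\<^sub>j\<close> at \<open>x^j\<close>; it is monic, because
  \<open>\<epsilon>\<^sub>0 = 1\<close>.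

  The proof rests on the differential equation \<open>G' = G (G/2 - 1)\<close>, which gives
  \<open>(G^(m p))' = m p G^(m p) (G/2 - 1)\<close>.  All series involved are Hurwitz series over the rationals
  with denominator prime to \<open>p\<close>, that is, their coefficients at \<open>t^n / n!\<close> are \<open>p\<close>-integral, and
  this property is preserved by products.  Reading the equation once shows that \<open>p\<close> divides
  \<open>\<epsilon>\<^sub>n\<close> for all \<open>n > 0\<close>, so \<open>G^(m p)\<close> is \<open>1\<close> modulo \<open>p\<close>
  (\<open>euler_series_power_mod_prime\<close>), and the polynomial is Eisenstein exactly
  if \<open>\<epsilon>\<^sub>m\<^sub>p\<close> is not divisible by \<open>p\<^sup>2\<close> (\<open>eisenstein_form_euler_poly_iff\<close>).
  Substituting this back on the right-hand side gives, with \<open>n = m p\<close>,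
  \<open>\<epsilon>\<^sub>n = p m E\<^sub>n\<^sub>-\<^sub>1 / 2\<close> modulo \<open>p\<^sup>2\<close>
  (\<open>higher_euler_number_Suc_mod_prime_squared\<close>).

  Modulo \<open>p\<close>, the number \<open>E\<^sub>n\<close> is the alternating power sum \<open>\<Sum> (-1)^j j^n\<close> over \<open>j < p\<close>, so by
  Fermat it depends, for \<open>n > 0\<close>, only on \<open>n\<close> modulo \<open>p - 1\<close>
  (\<open>euler_number_cong_mod_prime\<close>).  Since \<open>m p - 1 = (m - 1) + m (p - 1)\<close>,
  the index \<open>m p - 1\<close> may be replaced by \<open>m - 1\<close>, and \<open>m E\<^sub>m\<^sub>-\<^sub>1 / 2 = (1 - 2^m) B\<^sub>m\<close>
  (\<open>euler_number_bernoulli\<close>).  Hence the polynomial is Eisenstein exactly if \<open>p\<close> does not divide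
  \<open>(2^m - 1) B\<^sub>m\<close>.  The extra factor \<open>m\<close> in the criterion makes this number an integer and does
  not change divisibility by \<open>p\<close>: if \<open>p\<close> divides \<open>m\<close>, then it already divides
  \<open>(1 - 2^m) B\<^sub>m = m E\<^sub>m\<^sub>-\<^sub>1 / 2\<close>.
\<close>

section \<open>Rationals with denominator prime to \<open>p\<close>\<close>

text \<open>
  The localization of the integers at \<open>p\<close>.  Divisibility of \<open>x\<close> by \<open>p\<close> in this ring is written
  \<open>\<exists>y \<in> local_int p. x = of_nat p * y\<close> throughout.
\<close>

definition local_int :: "nat \<Rightarrow> rat set" where
  "local_int p = {of_int a / of_int b | a b. \<not> int p dvd b}"

lemma local_intI: "\<not> int p dvd b \<Longrightarrow> of_int a / of_int b \<in> local_int p"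
  by (auto simp: local_int_def)

lemma local_intE:
  assumes "x \<in> local_int p"
  obtains a b where "x = of_int a / of_int b" "\<not> int p dvd b" "b \<noteq> 0"
  using assms by (auto simp: local_int_def)

lemma local_int_of_int:
  assumes "prime p" shows "of_int a \<in> local_int p"
  using local_intI[of p 1 a] prime_gt_1_nat[OF assms] by auto

lemma local_int_basic:
  assumes "prime p"
  shows "0 \<in> local_int p" "1 \<in> local_int p" "of_nat n \<in> local_int p"
  using local_int_of_int[OF assms, of 0] local_int_of_int[OF assms, of 1]
    local_int_of_int[OF assms, of "int n"] by auto

lemma local_int_mult:
  assumes "prime p" "x \<in> local_int p" "y \<in> local_int p"
  shows "x * y \<in> local_int p"
proof -
  obtain a b where x: "x = of_int a / of_int b" "\<not> int p dvd b" using assms(2) by (rule local_intE)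
  obtain c d where y: "y = of_int c / of_int d" "\<not> int p dvd d" using assms(3) by (rule local_intE)
  have "\<not> int p dvd b * d" using x y assms(1) by (simp add: prime_dvd_mult_iff)
  from local_intI[OF this, of "a * c"] show ?thesis by (simp add: x y)
qed

lemma local_int_add:
  assumes "prime p" "x \<in> local_int p" "y \<in> local_int p"
  shows "x + y \<in> local_int p"
proof -
  obtain a b where x: "x = of_int a / of_int b" "\<not> int p dvd b" "b \<noteq> 0"
    using assms(2) by (rule local_intE)
  obtain c d where y: "y = of_int c / of_int d" "\<not> int p dvd d" "d \<noteq> 0"
    using assms(3) by (rule local_intE)
  have "\<not> int p dvd b * d" using x y assms(1) by (simp add: prime_dvd_mult_iff)
  from local_intI[OF this, of "a * d + c * b"] show ?thesis
    using x(3) y(3) by (simp add: x(1) y(1) field_simps)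
qed

lemma local_int_uminus:
  assumes "prime p" "x \<in> local_int p" shows "- x \<in> local_int p"
  using local_int_mult[OF assms(1) local_int_of_int[OF assms(1), of "-1"] assms(2)] by simp

lemma local_int_diff:
  assumes "prime p" "x \<in> local_int p" "y \<in> local_int p" shows "x - y \<in> local_int p"
  using local_int_add[OF assms(1,2) local_int_uminus[OF assms(1,3)]] by simp

lemma local_int_sum:
  assumes "prime p" "\<And>i. i \<in> A \<Longrightarrow> f i \<in> local_int p"
  shows "sum f A \<in> local_int p"
  using assms(2) by (induction A rule: infinite_finite_induct)
    (auto intro: local_int_add local_int_basic assms(1))

lemma int_if_local_int_everywhere:
  assumes "\<And>p. prime p \<Longrightarrow> x \<in> local_int p"
  shows "x \<in> \<int>"
proof -
  obtain r s where q: "quotient_of x = (r, s)" by force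
  have s: "s > 0" "coprime r s" and x: "x = of_int r / of_int s"
    using quotient_of_denom_pos[OF q] quotient_of_coprime[OF q] quotient_of_div[OF q] by auto
  have "s = 1"
  proof (rule ccontr)
    assume "s \<noteq> 1"
    then have "\<bar>s\<bar> \<noteq> 1" using s by auto
    then obtain q where q: "prime q" "q dvd s" using prime_divisor_exists[of s] s by auto
    define p where "p = nat q"
    have qp: "q = int p" using prime_ge_0_int[OF q(1)] by (simp add: p_def)
    have p: "prime p" using q(1) unfolding qp by simp
    obtain a b where ab: "x = of_int a / of_int b" "\<not> int p dvd b" "b \<noteq> 0"
      using assms[OF p] by (rule local_intE)
    have "(of_int (a * s) :: rat) = of_int (r * b)" using x ab s by (simp add: field_simps)
    then have "a * s = r * b" by (simp only: of_int_eq_iff)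
    then have "s dvd r * b" by (metis dvd_triv_right)
    then have "s dvd b" using s by (simp add: coprime_commute coprime_dvd_mult_right_iff)
    then show False using q ab qp dvd_trans by blast
  qed
  then show ?thesis using x by simp
qed

lemma prime_multiple_local_int_iff_dvd:
  assumes "prime p"
  shows "(\<exists>y \<in> local_int p. of_int k = of_nat p * y) \<longleftrightarrow> int p dvd k"
proof
  assume "\<exists>y \<in> local_int p. of_int k = of_nat p * y"
  then obtain a b where ab: "of_int k = of_nat p * (of_int a / of_int b :: rat)" "\<not> int p dvd b" "b \<noteq> 0"
    by (auto elim!: local_intE)
  then have "of_int (k * b) = (of_int (int p * a) :: rat)" by (simp add: field_simps)
  then have "k * b = int p * a" by (simp only: of_int_eq_iff)
  then have "int p dvd k * b" by simp
  then show "int p dvd k" using ab assms by (simp add: prime_dvd_mult_iff)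
next
  assume "int p dvd k"
  then obtain c where "k = int p * c" by auto
  then show "\<exists>y \<in> local_int p. of_int k = of_nat p * y"
    using local_int_of_int[OF assms, of c] by auto
qed

lemma padic_val_fraction:
  assumes "prime p" "a \<noteq> 0" "b \<noteq> 0"
  shows "padic_val p (of_int a / of_int b) =
           Fin (int (multiplicity (int p) a) - int (multiplicity (int p) b))"
proof -
  obtain r s where q: "quotient_of (of_int a / of_int b) = (r, s)" by force
  have s: "s > 0" and x: "(of_int a / of_int b :: rat) = of_int r / of_int s"
    using quotient_of_denom_pos[OF q] quotient_of_div[OF q] by auto
  have "(of_int (a * s) :: rat) = of_int (r * b)" using x s assms by (simp add: field_simps)
  then have e: "a * s = r * b" by (simp only: of_int_eq_iff)
  have r: "r \<noteq> 0" using e assms s by auto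
  have "multiplicity (int p) a + multiplicity (int p) s = multiplicity (int p) r + multiplicity (int p) b"
    using arg_cong[OF e, of "multiplicity (int p)"] assms s r
    by (simp add: prime_elem_multiplicity_mult_distrib)
  then show ?thesis using q assms by (simp add: padic_val_def)
qed

lemma padic_val_one: "padic_val p 1 = 0"
  by (simp add: padic_val_def zero_extended_def)

lemma padic_val_prime_multiple:
  assumes "prime p" "y \<in> local_int p"
  shows "padic_val p (of_nat p * y) \<ge> 1"
    and "padic_val p (of_nat p * y) = 1 \<longleftrightarrow> \<not> (\<exists>z \<in> local_int p. y = of_nat p * z)"
proof -
  obtain a b where y: "y = of_int a / of_int b" "\<not> int p dvd b" "b \<noteq> 0"
    using assms(2) by (rule local_intE)
  have p0: "p \<noteq> 0" using assms by auto
  have pn: "prime (int p)" using assms by simp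
  have iff: "(\<exists>z \<in> local_int p. y = of_nat p * z) \<longleftrightarrow> int p dvd a"
  proof
    assume "\<exists>z \<in> local_int p. y = of_nat p * z"
    then obtain z where z: "z \<in> local_int p" "y = of_nat p * z" by blast
    have "of_int a = of_nat p * (of_int b * z)" using z(2) y by (simp add: field_simps)
    moreover have "of_int b * z \<in> local_int p"
      using assms(1) z(1) by (intro local_int_mult local_int_of_int)
    ultimately show "int p dvd a" using prime_multiple_local_int_iff_dvd[OF assms(1), of a] by blast
  next
    assume "int p dvd a"
    then obtain c where "a = int p * c" by auto
    then show "\<exists>z \<in> local_int p. y = of_nat p * z"
      using y local_intI[OF y(2), of c] by (intro bexI[of _ "of_int c / of_int b"]) auto
  qed
  have v: "padic_val p (of_nat p * y) = Fin (1 + int (multiplicity (int p) a))" if "a \<noteq> 0"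
  proof -
    have "of_nat p * y = of_int (int p * a) / of_int b" using y by simp
    moreover have "multiplicity (int p) (int p * a) = Suc (multiplicity (int p) a)"
      using that pn p0 by (intro multiplicity_times_same) auto
    moreover have "multiplicity (int p) b = 0" using y by (simp add: not_dvd_imp_multiplicity_0)
    ultimately show ?thesis using padic_val_fraction[of p "int p * a" b] that p0 y assms(1) by simp
  qed
  show "padic_val p (of_nat p * y) \<ge> 1"
    by (cases "a = 0") (use v y in \<open>auto simp: padic_val_def one_extended_def\<close>)
  show "padic_val p (of_nat p * y) = 1 \<longleftrightarrow> \<not> (\<exists>z \<in> local_int p. y = of_nat p * z)"
  proof (cases "a = 0")
    case True
    then show ?thesis using y iff by (auto simp: padic_val_def one_extended_def)
  next
    case False
    have "multiplicity (int p) a = 0 \<longleftrightarrow> \<not> int p dvd a"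
      using False pn by (intro multiplicity_eq_zero_iff) auto
    then show ?thesis using iff v[OF False] by (auto simp: one_extended_def)
  qed
qed

section \<open>Hurwitz series\<close>

definition hurwitz :: "nat \<Rightarrow> rat fps set" where
  "hurwitz p = {F. \<forall>n. fact n * fps_nth F n \<in> local_int p}"

lemma hurwitzD: "F \<in> hurwitz p \<Longrightarrow> fact n * fps_nth F n \<in> local_int p"
  by (simp add: hurwitz_def)

text \<open>
  On the coefficients of \<open>t^n / n!\<close>, multiplication of series is binomial convolution, which involves
  integer factors only; this is why Hurwitz series are closed under products.
\<close>

lemma hurwitz_coeff_mult:
  "fact n * fps_nth (F * G) n =
     (\<Sum>i\<le>n. of_nat (n choose i) * (fact i * fps_nth F i) * (fact (n - i) * fps_nth G (n - i)) :: rat)"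
  unfolding fps_mult_nth atLeast0AtMost sum_distrib_left
  by (rule sum.cong) (auto simp: binomial_fact field_simps)

lemma hurwitz_mult:
  assumes "prime p" "F \<in> hurwitz p" "G \<in> hurwitz p"
  shows "F * G \<in> hurwitz p"
  unfolding hurwitz_def hurwitz_coeff_mult mem_Collect_eq
  by (intro allI local_int_sum local_int_mult local_int_basic hurwitzD assms)

lemma hurwitz_add:
  assumes "prime p" "F \<in> hurwitz p" "G \<in> hurwitz p"
  shows "F + G \<in> hurwitz p"
  using assms by (auto simp: hurwitz_def distrib_left intro: local_int_add)

lemma hurwitz_diff:
  assumes "prime p" "F \<in> hurwitz p" "G \<in> hurwitz p"
  shows "F - G \<in> hurwitz p"
  using assms by (auto simp: hurwitz_def right_diff_distrib intro: local_int_diff)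

lemma hurwitz_const:
  assumes "prime p" "c \<in> local_int p" shows "fps_const c \<in> hurwitz p"
  using assms by (auto simp: hurwitz_def local_int_basic)

lemma hurwitz_one: "prime p \<Longrightarrow> 1 \<in> hurwitz p"
  using hurwitz_const[of p 1] by (simp add: local_int_basic)

lemma hurwitz_power:
  assumes "prime p" "F \<in> hurwitz p" shows "F ^ n \<in> hurwitz p"
  by (induction n) (auto intro: hurwitz_mult hurwitz_one assms)

lemma hurwitz_exp: "prime p \<Longrightarrow> fps_exp 1 \<in> hurwitz p"
  by (simp add: hurwitz_def local_int_basic)

text \<open>
  A Hurwitz series with constant term \<open>1\<close> is a unit among the Hurwitz series: the binomial
  convolution can be solved for the coefficients of the other factor without any division.
\<close>

lemma hurwitz_cofactor:
  assumes p: "prime p" and "F \<in> hurwitz p" "F * G \<in> hurwitz p" "fps_nth F 0 = 1"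
  shows "G \<in> hurwitz p"
proof -
  have "fact n * fps_nth G n \<in> local_int p" for n
  proof (induction n rule: less_induct)
    case (less n)
    let ?s = "\<Sum>i\<in>{1..n}. of_nat (n choose i) * (fact i * fps_nth F i) * (fact (n - i) * fps_nth G (n - i))"
    have "{..n} = insert 0 {1..n}" by auto
    then have "fact n * fps_nth (F * G) n = fact n * fps_nth G n + ?s"
      unfolding hurwitz_coeff_mult using assms by simp
    moreover have "?s \<in> local_int p"
      by (rule local_int_sum[OF p], intro local_int_mult p local_int_basic hurwitzD[OF assms(2)] less) auto
    ultimately show ?case
      using local_int_diff[OF p hurwitzD[OF assms(3), of n], of ?s] by simp
  qed
  then show ?thesis by (simp add: hurwitz_def)
qed

section \<open>Euler numbers\<close>

definition euler_series :: "rat fps" where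
  "euler_series = 2 / (fps_exp 1 + 1)"

definition euler_number :: "nat \<Rightarrow> rat" where
  "euler_number n = fact n * fps_nth euler_series n"

lemma euler_series_mult: "euler_series * (fps_exp 1 + 1) = 2"
  unfolding euler_series_def by (simp add: fps_divide_unit mult.assoc inverse_mult_eq_1)

lemma euler_series_0: "fps_nth euler_series 0 = 1"
  using arg_cong[OF euler_series_mult, of "\<lambda>F. fps_nth F 0"] by simp

lemma exp_plus_one_nonzero: "fps_exp 1 + 1 \<noteq> (0 :: rat fps)"
  by (auto simp: fps_eq_iff intro!: exI[of _ 0])

lemma half_two: "fps_const (1/2) * 2 = (1 :: rat fps)"
  by (simp add: fps_numeral_fps_const flip: fps_const_mult)

text \<open>
  Differentiating \<open>G (e\<^sup>t + 1) = 2\<close> gives \<open>G' (e\<^sup>t + 1) = - G e\<^sup>t\<close>; the exponential is then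
  eliminated by \<open>e\<^sup>t = (e\<^sup>t + 1) - 1\<close> and \<open>1 / (e\<^sup>t + 1) = G / 2\<close>.
\<close>

lemma euler_series_deriv:
  "fps_deriv euler_series = euler_series * (fps_const (1/2) * euler_series - 1)"
proof -
  have d: "fps_deriv euler_series * (fps_exp 1 + 1) = - euler_series * fps_exp 1"
    using arg_cong[OF euler_series_mult, of fps_deriv] by (simp add: eq_neg_iff_add_eq_0 add.commute)
  have "euler_series * (fps_const (1/2) * euler_series - 1) * (fps_exp 1 + 1)
      = euler_series * (fps_const (1/2) * (euler_series * (fps_exp 1 + 1)) - (fps_exp 1 + 1))"
    by (simp add: algebra_simps)
  also have "\<dots> = - euler_series * fps_exp 1"
    unfolding euler_series_mult half_two by (simp add: algebra_simps)
  finally show ?thesis using d exp_plus_one_nonzero by (metis mult_right_cancel)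
qed

lemma half_local_int: "prime p \<Longrightarrow> odd p \<Longrightarrow> 1/2 \<in> local_int p"
proof -
  assume "prime p" "odd p"
  then have "\<not> p dvd 2" using primes_dvd_imp_eq[of p 2] by auto
  then have "\<not> int p dvd 2" using int_dvd_int_iff[of p 2] by simp
  then show ?thesis using local_intI[of p 2 1] by simp
qed

lemma hurwitz_euler_series:
  assumes "prime p" "odd p" shows "euler_series \<in> hurwitz p"
proof (rule hurwitz_cofactor[OF assms(1)])
  let ?F = "fps_const (1/2) * (fps_exp 1 + 1) :: rat fps"
  show "?F \<in> hurwitz p"
    using assms by (intro hurwitz_mult hurwitz_const hurwitz_add hurwitz_exp hurwitz_one half_local_int)
  have "?F * euler_series = fps_const (1/2) * (euler_series * (fps_exp 1 + 1))"
    by (simp only: ac_simps)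
  then have "?F * euler_series = 1" unfolding euler_series_mult half_two .
  then show "?F * euler_series \<in> hurwitz p" using assms by (simp add: hurwitz_one)
  show "fps_nth ?F 0 = 1" by simp
qed

lemma euler_number_local_int:
  assumes "prime p" "odd p" shows "euler_number n \<in> local_int p"
  unfolding euler_number_def using hurwitz_euler_series[OF assms] by (rule hurwitzD)

text \<open>
  Because \<open>p\<close> is odd, \<open>1 + e^(p t) = (1 + e\<^sup>t) (1 - e\<^sup>t + \<dots> + e^((p - 1) t))\<close>, and the left-hand side
  is \<open>2\<close> modulo \<open>p\<close> as a Hurwitz series.  Multiplying by \<open>G / 2\<close> therefore turns the alternating sum
  of exponentials into \<open>G\<close> modulo \<open>p\<close>.
\<close>

lemma euler_number_alternating_power_sum:
  assumes p: "prime p" and o: "odd p"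
  shows "\<exists>z \<in> local_int p. euler_number n = (\<Sum>j<p. (-1) ^ j * of_nat j ^ n) + of_nat p * z"
proof -
  define A :: "rat fps" where "A = (\<Sum>j<p. (-1) ^ j * fps_exp (of_nat j))"
  \<comment> \<open>\<open>H\<close> is \<open>(e^(p t) - 1) / p\<close>.\<close>
  define H :: "rat fps" where "H = Abs_fps (\<lambda>k. if k = 0 then 0 else of_nat p ^ (k - 1) / fact k)"
  have "fps_exp (of_nat j) = fps_exp (1::rat) ^ j" for j by (simp add: fps_exp_power_mult)
  then have "A = (\<Sum>j<p. (- fps_exp 1) ^ j)" by (simp add: A_def power_minus[of "fps_exp 1"])
  then have "(1 + fps_exp 1) * A = 1 - (- fps_exp 1) ^ p"
    by (simp add: one_diff_power_eq[of _ p])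
  also have "\<dots> = 1 + fps_exp (of_nat p)" using o by (simp add: fps_exp_power_mult)
  also have "\<dots> = 2 + fps_const (of_nat p) * H"
    by (auto simp: fps_eq_iff H_def fps_numeral_nth power_eq_if)
  finally have A: "(1 + fps_exp 1) * A = 2 + fps_const (of_nat p) * H" .
  have "2 * A = (euler_series * (fps_exp 1 + 1)) * A" by (simp only: euler_series_mult)
  also have "\<dots> = euler_series * (2 + fps_const (of_nat p) * H)" unfolding A[symmetric] by (simp only: ac_simps)
  finally have A2: "2 * A = euler_series * (2 + fps_const (of_nat p) * H)" .
  define W where "W = fps_const (1/2) * euler_series * H"
  have "A = fps_const (1/2) * (2 * A)" by (simp only: mult.assoc[symmetric] half_two mult_1_left)
  also have "\<dots> = (fps_const (1/2) * 2) * euler_series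
      + fps_const (of_nat p) * W"
    unfolding A2 by (simp only: W_def algebra_simps)
  finally have eq: "A = euler_series + fps_const (of_nat p) * W"
    unfolding half_two by simp
  have "H \<in> hurwitz p"
    using local_int_basic(3)[OF p, of "p ^ _"] by (auto simp: hurwitz_def H_def local_int_basic p)
  then have "W \<in> hurwitz p"
    unfolding W_def using p o by (intro hurwitz_mult hurwitz_const half_local_int hurwitz_euler_series)
  note z = hurwitzD[OF this, of n]
  have sgn: "(-1) ^ j = fps_const ((-1) ^ j :: rat)" for j
    by (metis fps_const_1_eq_1 fps_const_neg fps_const_power)
  have "fact n * fps_nth A n = (\<Sum>j<p. (-1) ^ j * of_nat j ^ n)"
    by (simp add: A_def sgn fps_sum_nth sum_distrib_left)
  moreover have "fact n * fps_nth A n = euler_number n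
      + of_nat p * (fact n * fps_nth W n)"
    by (subst eq) (simp add: euler_number_def algebra_simps)
  ultimately show ?thesis using local_int_uminus[OF p z]
    by (intro bexI[of _ "- (fact n * fps_nth W n)"]) auto
qed

lemma fermat_power:
  fixes j p :: nat
  assumes "prime p" "n > 0"
  shows "int p dvd int j ^ (n + k * (p - 1)) - int j ^ n"
proof (cases "p dvd j")
  case True
  then have "int p dvd int j ^ (n + k * (p - 1))" "int p dvd int j ^ n"
    using assms by (auto simp: prime_dvd_power_iff)
  then show ?thesis by (rule dvd_diff)
next
  case False
  have "[j ^ (p - 1) = 1] (mod p)" using assms(1) False by (rule fermat_theorem)
  then have "[(j ^ (p - 1)) ^ k = 1 ^ k] (mod p)" by (rule cong_pow)
  then have "[j ^ n * (j ^ (p - 1)) ^ k = j ^ n * 1] (mod p)" by (intro cong_mult) auto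
  then have "[j ^ (n + k * (p - 1)) = j ^ n] (mod p)"
    by (simp add: power_add power_mult mult.commute[of k])
  then show ?thesis by (metis cong_iff_dvd_diff cong_int_iff of_nat_power)
qed

text \<open>
  A Kummer-type congruence.  It fails for \<open>n = 0\<close> because the term \<open>j = 0\<close> of the power sum then
  contributes \<open>0^0 = 1\<close>.
\<close>

lemma euler_number_cong_mod_prime:
  assumes p: "prime p" and o: "odd p" and n: "n > 0"
  shows "\<exists>z \<in> local_int p. euler_number (n + k * (p - 1)) = euler_number n + of_nat p * z"
proof -
  let ?N = "n + k * (p - 1)"
  let ?S = "\<lambda>n. (\<Sum>j<p. (-1) ^ j * int j ^ n)"
  obtain y where y: "y \<in> local_int p" "euler_number n = of_int (?S n) + of_nat p * y"
    using euler_number_alternating_power_sum[OF p o, of n] by auto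
  obtain z where z: "z \<in> local_int p" "euler_number ?N = of_int (?S ?N) + of_nat p * z"
    using euler_number_alternating_power_sum[OF p o, of ?N] by auto
  have "int p dvd (\<Sum>j<p. (-1) ^ j * (int j ^ ?N - int j ^ n))"
    by (intro dvd_sum dvd_mult fermat_power p n)
  then have "int p dvd ?S ?N - ?S n" by (simp add: sum_subtractf right_diff_distrib)
  then obtain c where "?S ?N - ?S n = int p * c" by auto
  then have c: "?S ?N = ?S n + int p * c" by simp
  have "euler_number ?N = euler_number n + of_nat p * (of_int c + z - y)"
    unfolding y z c by (simp add: algebra_simps)
  moreover have "of_int c + z - y \<in> local_int p"
    using p y z by (intro local_int_diff local_int_add local_int_of_int)
  ultimately show ?thesis by blast
qed

section \<open>Powers of the Euler series\<close>

lemma deriv_euler_series_power: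
  "fps_deriv (euler_series ^ n) = of_nat n * euler_series ^ n * (fps_const (1/2) * euler_series - 1)"
proof (induction n)
  case (Suc n)
  let ?L = "fps_const (1/2) * euler_series - 1"
  have "fps_deriv (euler_series ^ Suc n) =
      euler_series * (of_nat n * euler_series ^ n * ?L) + euler_series * ?L * euler_series ^ n"
    by (simp only: power_Suc fps_deriv_mult Suc euler_series_deriv)
  also have "\<dots> = of_nat (Suc n) * euler_series ^ Suc n * ?L"
    by (simp only: power_Suc of_nat_Suc algebra_simps mult_1_left)
  finally show ?case .
qed simp

definition higher_euler_number :: "nat \<Rightarrow> nat \<Rightarrow> rat" where
  "higher_euler_number m n = fact n * fps_nth (euler_series ^ m) n"

lemma higher_euler_number_Suc:
  "higher_euler_number m (Suc n) = of_nat m *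
     (fact n * fps_nth (euler_series ^ m * (fps_const (1/2) * euler_series - 1)) n)"
proof -
  have "higher_euler_number m (Suc n) = fact n * fps_nth (fps_deriv (euler_series ^ m)) n"
    by (simp add: higher_euler_number_def algebra_simps)
  also have "\<dots> = fact n * fps_nth (fps_const (of_nat m) * (euler_series ^ m * (fps_const (1/2) * euler_series - 1))) n"
    by (simp only: deriv_euler_series_power fps_of_nat mult.assoc)
  finally show ?thesis unfolding fps_mult_left_const_nth by (simp only: ac_simps)
qed

text \<open>
  The factor \<open>m p\<close> produced by differentiating a power with exponent \<open>m p\<close> supplies the factor \<open>p\<close>.
\<close>

lemma higher_euler_number_prime_multiple:
  assumes p: "prime p" and o: "odd p" and n: "n > 0"
  shows "\<exists>z \<in> local_int p. higher_euler_number (m * p) n = of_nat p * z"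
proof -
  obtain k where k: "n = Suc k" using n by (cases n) auto
  let ?F = "euler_series ^ (m * p) * (fps_const (1/2) * euler_series - 1)"
  have "?F \<in> hurwitz p"
    using p o by (intro hurwitz_mult hurwitz_power hurwitz_diff hurwitz_const hurwitz_one
        half_local_int hurwitz_euler_series)
  from local_int_mult[OF p local_int_basic(3)[OF p] hurwitzD[OF this]]
  have "of_nat m * (fact k * fps_nth ?F k) \<in> local_int p" .
  moreover have "higher_euler_number (m * p) n = of_nat p * (of_nat m * (fact k * fps_nth ?F k))"
    unfolding k higher_euler_number_Suc by simp
  ultimately show ?thesis by blast
qed

lemma euler_series_power_mod_prime:
  assumes p: "prime p" and o: "odd p"
  shows "\<exists>V \<in> hurwitz p. euler_series ^ (m * p) = 1 + fps_const (of_nat p) * V"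
proof -
  define V where "V = fps_const (1 / of_nat p) * (euler_series ^ (m * p) - 1)"
  have p0: "(of_nat p :: rat) \<noteq> 0" using p by auto
  have "fact n * fps_nth V n \<in> local_int p" for n
  proof (cases "n = 0")
    case True
    then show ?thesis by (simp add: V_def euler_series_0 fps_nth_power_0 local_int_basic p)
  next
    case False
    then obtain z where "z \<in> local_int p" "higher_euler_number (m * p) n = of_nat p * z"
      using higher_euler_number_prime_multiple[OF p o] by blast
    then show ?thesis using False p0 by (simp add: V_def higher_euler_number_def field_simps)
  qed
  moreover have "fps_const (of_nat p) * V = fps_const (of_nat p * (1 / of_nat p)) * (euler_series ^ (m * p) - 1)"
    by (simp only: V_def fps_const_mult[symmetric] mult.assoc)
  then have "euler_series ^ (m * p) = 1 + fps_const (of_nat p) * V" using p0 by simp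
  ultimately show ?thesis by (auto simp: hurwitz_def)
qed

text \<open>
  The derivative of \<open>G^(m p)\<close> carries a factor \<open>p\<close>, so knowing \<open>G^(m p)\<close> modulo \<open>p\<close> on the
  right-hand side of the differential equation determines the left-hand side modulo \<open>p\<^sup>2\<close>.
\<close>

lemma higher_euler_number_Suc_mod_prime_squared:
  assumes p: "prime p" and o: "odd p" and n: "n > 0"
  shows "\<exists>z \<in> local_int p. higher_euler_number (m * p) (Suc n) =
           of_nat p * (of_nat m * euler_number n / 2 + of_nat p * z)"
proof -
  let ?L = "fps_const (1/2) * euler_series - 1"
  obtain V where V: "V \<in> hurwitz p" "euler_series ^ (m * p) = 1 + fps_const (of_nat p) * V"
    using euler_series_power_mod_prime[OF p o] by blast
  define W where "W = V * ?L"
  have "W \<in> hurwitz p"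
    unfolding W_def using p o V by (intro hurwitz_mult hurwitz_diff hurwitz_const hurwitz_one
        half_local_int hurwitz_euler_series)
  from local_int_mult[OF p local_int_basic(3)[OF p] hurwitzD[OF this]]
  have "of_nat m * (fact n * fps_nth W n) \<in> local_int p" .
  moreover have e: "euler_series ^ (m * p) * ?L = ?L + fps_const (of_nat p) * W"
    unfolding V(2) W_def by (simp add: algebra_simps)
  have "higher_euler_number (m * p) (Suc n) =
           of_nat p * (of_nat m * euler_number n / 2 + of_nat p * (of_nat m * (fact n * fps_nth W n)))"
    unfolding higher_euler_number_Suc e using n
    by (simp add: euler_number_def algebra_simps)
  ultimately show ?thesis by blast
qed

section \<open>Bernoulli numbers and integrality\<close>

lemma bernoulli_times_exp: "Abs_fps (\<lambda>n. bernoulli n / fact n) * (fps_exp 1 - 1) = fps_X"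
  using bernoulli_quotient_exact by (simp add: bernoulli_generating_function)

text \<open>
  With \<open>b(t) = t / (e\<^sup>t - 1)\<close> this compares coefficients in
  \<open>b(t) - b(2 t) = t / (e\<^sup>t + 1) = t G(t) / 2\<close>.
\<close>

lemma euler_number_bernoulli:
  assumes "m > 0"
  shows "of_nat m * euler_number (m - 1) / 2 = (1 - 2 ^ m) * bernoulli m"
proof -
  define b :: "rat fps" where "b = Abs_fps (\<lambda>n. bernoulli n / fact n)"
  define E :: "rat fps" where "E = fps_exp 1"
  define b2 where "b2 = b oo (fps_const 2 * fps_X)"
  have b: "b * (E - 1) = fps_X" unfolding b_def E_def by (rule bernoulli_times_exp)
  have E2: "E oo (fps_const 2 * fps_X) = E ^ 2"
    by (simp add: E_def fps_exp_power_mult fps_compose_linear fps_eq_iff)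
  have "(b * (E - 1)) oo (fps_const 2 * fps_X) = b2 * (E ^ 2 - 1)"
    by (simp add: fps_compose_mult_distrib fps_compose_sub_distrib E2 b2_def)
  then have b2: "b2 * (E ^ 2 - 1) = 2 * fps_X"
    by (simp add: b fps_numeral_fps_const)
  have sq: "E ^ 2 - 1 = (E - 1) * (E + 1)" by (simp add: power2_eq_square algebra_simps)
  have "(b - b2) * (E ^ 2 - 1) = (b * (E - 1)) * (E + 1) - b2 * (E ^ 2 - 1)"
    unfolding sq by (simp add: algebra_simps)
  also have "\<dots> = fps_X * (E - 1)" unfolding b b2 by (simp add: algebra_simps)
  also have "\<dots> = fps_X * (E - 1) * (fps_const (1/2) * 2)" unfolding half_two by simp
  also have "\<dots> = fps_X * (E - 1) * (fps_const (1/2) * (euler_series * (E + 1)))"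
    unfolding E_def euler_series_mult ..
  also have "\<dots> = (fps_const (1/2) * (fps_X * euler_series)) * (E ^ 2 - 1)"
    unfolding sq by (simp only: ac_simps)
  finally have "(b - b2) * (E ^ 2 - 1) = (fps_const (1/2) * (fps_X * euler_series)) * (E ^ 2 - 1)" .
  moreover have "E ^ 2 - 1 \<noteq> 0"
    using b2 by auto
  ultimately have "b - b2 = fps_const (1/2) * (fps_X * euler_series)" by (metis mult_right_cancel)
  then have "fps_nth (b - b2) m = fps_nth (fps_const (1/2) * (fps_X * euler_series)) m" by simp
  moreover have b2m: "fps_nth b2 m = 2 ^ m * bernoulli m / fact m"
    unfolding b2_def fps_compose_linear by (simp add: b_def)
  ultimately have c: "(1 - 2 ^ m) * bernoulli m = fact m * fps_nth euler_series (m - 1) / 2"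
    using assms b2m by (simp add: b_def field_simps)
  have "(fact m :: rat) = of_nat m * fact (m - 1)" using assms by (simp add: fact_reduce)
  then show ?thesis using c by (simp add: euler_number_def)
qed

text \<open>
  If \<open>2^a\<close> is the power of two in \<open>n + 1\<close>, then \<open>a < 2^a \<le> n + 1\<close>, so \<open>2^n\<close> absorbs it.
\<close>

lemma two_power_div_Suc_local_int: "2 ^ n / of_nat (Suc n) \<in> local_int 2"
proof -
  obtain a c where ac: "Suc n = 2 ^ a * c" "odd c"
    using multiplicity_decompose'[of "Suc n" 2] by (metis One_nat_def nat.simps(3) not_is_unit_0 odd_one mult.commute)
  have "2 ^ a \<le> Suc n" using ac by (cases c) auto
  moreover have "a < 2 ^ a" by (rule less_exp)
  ultimately have "a \<le> n" by linarith
  then have "2 ^ n = 2 ^ a * (2 ^ (n - a) :: rat)" by (simp flip: power_add)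
  then have "2 ^ n / of_nat (Suc n) = (of_int (2 ^ (n - a)) / of_int (int c) :: rat)"
    unfolding ac by simp
  also have "\<dots> \<in> local_int 2" using ac by (intro local_intI) auto
  finally show ?thesis .
qed

text \<open>
  The case of the prime two in the theorem of von Staudt and Clausen.  It follows from
  \<open>2 t / (e\<^sup>t - 1) = (e\<^sup>t + 1) / h\<close> with \<open>h = (e^(2 t) - 1) / (2 t)\<close>: the coefficients of \<open>h\<close> at
  \<open>t^n / n!\<close> are \<open>2^n / (n + 1)\<close>, so \<open>h\<close> is a unit among the Hurwitz series at two.
\<close>

lemma two_bernoulli_local_int: "2 * bernoulli n \<in> local_int 2"
proof -
  define b :: "rat fps" where "b = Abs_fps (\<lambda>n. bernoulli n / fact n)"
  define E :: "rat fps" where "E = fps_exp 1"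
  define h :: "rat fps" where "h = Abs_fps (\<lambda>n. 2 ^ n / fact (Suc n))"
  have two: "prime (2::nat)" by simp
  have b: "b * (E - 1) = fps_X" unfolding b_def E_def by (rule bernoulli_times_exp)
  have hX: "h * (2 * fps_X) = E ^ 2 - 1"
  proof (rule fps_ext)
    fix n
    have "h * (2 * fps_X) = fps_const 2 * (fps_X * h)"
      by (simp only: fps_numeral_fps_const ac_simps)
    then have "fps_nth (h * (2 * fps_X)) n = 2 * fps_nth (fps_X * h) n"
      by (simp only: fps_mult_left_const_nth)
    then show "fps_nth (h * (2 * fps_X)) n = fps_nth (E ^ 2 - 1) n"
      unfolding E_def h_def by (cases n) (simp_all add: fps_exp_power_mult distrib_right)
  qed
  have "(h * (2 * b)) * fps_X = (h * (2 * fps_X)) * b" by (simp only: ac_simps)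
  also have "\<dots> = (b * (E - 1)) * (E + 1)"
    unfolding hX by (simp add: power2_eq_square algebra_simps)
  also have "\<dots> = (E + 1) * fps_X" unfolding b by (simp only: ac_simps)
  finally have "h * (2 * b) = E + 1" by (metis mult_right_cancel fps_X_neq_zero)
  then have "h * (2 * b) \<in> hurwitz 2"
    unfolding E_def by (simp add: hurwitz_add hurwitz_exp hurwitz_one)
  moreover have "fact n * fps_nth h n = 2 ^ n / of_nat (Suc n)" for n
    by (simp add: h_def field_simps del: of_nat_Suc)
  then have "h \<in> hurwitz 2"
    unfolding hurwitz_def using two_power_div_Suc_local_int by simp
  moreover have "fps_nth h 0 = 1" by (simp add: h_def)
  ultimately have "2 * b \<in> hurwitz 2" using hurwitz_cofactor[OF two] by blast
  from hurwitzD[OF this, of n] show ?thesis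
    by (simp add: b_def fps_numeral_fps_const)
qed

text \<open>
  Integrality is checked one prime at a time.  At odd primes the number is \<open>- m\<^sup>2 E\<^sub>m\<^sub>-\<^sub>1 / 2\<close>, which has
  no odd denominator; at two, the even factor \<open>m\<close> cancels the denominator of \<open>B\<^sub>m\<close>.
\<close>

lemma even_index_bernoulli_multiple_integral:
  assumes "even m" "m > 0"
  shows "of_nat m * (2 ^ m - 1) * bernoulli m \<in> \<int>"
proof (rule int_if_local_int_everywhere)
  fix p :: nat assume p: "prime p"
  show "of_nat m * (2 ^ m - 1) * bernoulli m \<in> local_int p"
  proof (cases "p = 2")
    case True
    obtain c where c: "m = 2 * c" using assms by auto
    have b: "2 * bernoulli m \<in> local_int p"
      using two_bernoulli_local_int True by simp
    have "of_nat m * (2 ^ m - 1) * bernoulli m = of_int (int c * (2 ^ m - 1)) * (2 * bernoulli m)"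
      by (simp add: c)
    also have "\<dots> \<in> local_int p" by (rule local_int_mult[OF p local_int_of_int[OF p] b])
    finally show ?thesis .
  next
    case False
    have o: "odd p" using p False primes_dvd_imp_eq two_is_prime_nat by blast
    have "of_nat m * (2 ^ m - 1) * bernoulli m = - of_nat m * ((1 - 2 ^ m) * bernoulli m)"
      by (simp add: algebra_simps)
    also have "\<dots> = of_int (- int m * int m) * (1/2) * euler_number (m - 1)"
      unfolding euler_number_bernoulli[OF assms(2), symmetric] by simp
    also have "\<dots> \<in> local_int p"
      using p o by (intro local_int_mult local_int_of_int half_local_int euler_number_local_int)
    finally show ?thesis .
  qed
qed

section \<open>The Eisenstein criterion\<close>

lemma coeff_euler_poly:
  "coeff (euler_poly m n) j = (if j \<le> n then of_nat (n choose j) * higher_euler_number m (n - j) else 0)"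
proof -
  have "coeff (euler_poly m n) j =
     fact n * (\<Sum>i\<le>n. fps_nth (euler_series ^ m) i * (if n - i = j then 1 / fact (n - i) else 0))"
    by (simp add: euler_poly_def exp_tx_def const_coeffs_def fps_mult_nth atLeast0AtMost coeff_sum
        euler_series_def)
  also have "(\<Sum>i\<le>n. fps_nth (euler_series ^ m) i * (if n - i = j then 1 / fact (n - i) else 0)) =
     (\<Sum>i\<le>n. if i = n - j then (if j \<le> n then fps_nth (euler_series ^ m) (n - j) / fact j else 0) else 0)"
    by (rule sum.cong) auto
  finally show ?thesis
    by (auto simp: higher_euler_number_def binomial_fact field_simps)
qed

lemma coeff_euler_poly_top: "coeff (euler_poly m n) n = 1"
  by (simp add: coeff_euler_poly higher_euler_number_def fps_nth_power_0 euler_series_0)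

lemma degree_euler_poly: "degree (euler_poly m n) = n"
proof (rule antisym)
  show "degree (euler_poly m n) \<le> n" by (rule degree_le) (simp add: coeff_euler_poly)
  show "n \<le> degree (euler_poly m n)" by (rule le_degree) (simp add: coeff_euler_poly_top)
qed

text \<open>
  Every coefficient below the leading one is an integer multiple of some \<open>\<epsilon>\<^sub>i\<close> with \<open>i > 0\<close>, hence
  divisible by \<open>p\<close>; only the exact valuation of the constant term remains as a condition.
\<close>

lemma eisenstein_form_euler_poly_iff:
  assumes "prime p" "odd p" "n > 0"
  shows "eisenstein_form p (euler_poly (m * p) n) \<longleftrightarrow> padic_val p (higher_euler_number (m * p) n) = 1"
proof -
  have "padic_val p (coeff (euler_poly (m * p) n) j) \<ge> 1" if "j < n" for j
  proof -
    obtain z where z: "z \<in> local_int p" "higher_euler_number (m * p) (n - j) = of_nat p * z"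
      using higher_euler_number_prime_multiple[OF assms(1,2), of "n - j"] \<open>j < n\<close> by auto
    have "of_nat (n choose j) * z \<in> local_int p"
      using assms z by (intro local_int_mult local_int_basic)
    from padic_val_prime_multiple(1)[OF assms(1) this] show ?thesis
      using z \<open>j < n\<close> by (simp add: coeff_euler_poly mult.left_commute)
  qed
  moreover have "coeff (euler_poly (m * p) n) 0 = higher_euler_number (m * p) n"
    by (simp add: coeff_euler_poly)
  ultimately show ?thesis
    by (simp add: eisenstein_form_def degree_euler_poly coeff_euler_poly_top padic_val_one)
qed

text \<open>
  Here \<open>m > 1\<close> keeps both indices \<open>m - 1\<close> and \<open>m p - 1\<close> positive, as the congruence between the
  Euler numbers requires.
\<close>

lemma higher_euler_number_bernoulli:
  assumes p: "prime p" and o: "odd p" and m: "m > 1"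
  shows "\<exists>w \<in> local_int p. higher_euler_number (m * p) (m * p) =
           of_nat p * ((1 - 2 ^ m) * bernoulli m + of_nat p * w)"
proof -
  define n where "n = m - 1 + m * (p - 1)"
  have n: "m * p = Suc n" using m prime_gt_0_nat[OF p] by (cases p) (auto simp: n_def)
  have pos: "m - 1 > 0" "n > 0" using m by (auto simp: n_def)
  obtain y where y: "y \<in> local_int p" "euler_number n = euler_number (m - 1) + of_nat p * y"
    using euler_number_cong_mod_prime[OF p o pos(1), of m] unfolding n_def by blast
  obtain z where z: "z \<in> local_int p" "higher_euler_number (m * p) (Suc n) =
                of_nat p * (of_nat m * euler_number n / 2 + of_nat p * z)"
    using higher_euler_number_Suc_mod_prime_squared[OF p o pos(2)] by blast
  have "of_nat m * (1/2) * y + z \<in> local_int p"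
    by (intro local_int_add local_int_mult local_int_basic half_local_int p o y z)
  moreover have "(1 - 2 ^ m) * bernoulli m = of_nat m * euler_number (m - 1) / 2"
    using euler_number_bernoulli m by simp
  then have "higher_euler_number (m * p) (m * p) =
      of_nat p * ((1 - 2 ^ m) * bernoulli m + of_nat p * (of_nat m * (1/2) * y + z))"
    using z(2) unfolding n y(2) by (simp only:) (simp add: algebra_simps)
  ultimately show ?thesis by blast
qed

lemma prime_multiple_add_iff:
  assumes "prime p" "w \<in> local_int p"
  shows "(\<exists>v \<in> local_int p. x + of_nat p * w = of_nat p * v) \<longleftrightarrow> (\<exists>v \<in> local_int p. x = of_nat p * v)"
proof (intro iffI; elim bexE)
  fix v assume "v \<in> local_int p" "x + of_nat p * w = of_nat p * v"
  then show "\<exists>v \<in> local_int p. x = of_nat p * v"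
    using assms by (intro bexI[of _ "v - w"] local_int_diff) (auto simp: algebra_simps)
next
  fix v assume "v \<in> local_int p" "x = of_nat p * v"
  then show "\<exists>v \<in> local_int p. x + of_nat p * w = of_nat p * v"
    using assms by (intro bexI[of _ "v + w"] local_int_add) (auto simp: algebra_simps)
qed

text \<open>
  The integer \<open>k\<close> is \<open>- m\<close> times \<open>(1 - 2^m) B\<^sub>m\<close>.  If \<open>p\<close> does not divide \<open>m\<close>, this factor is a unit at
  \<open>p\<close>; otherwise both sides hold, since \<open>(1 - 2^m) B\<^sub>m\<close> is itself \<open>m\<close> times a \<open>p\<close>-integral number.
\<close>

lemma prime_multiple_bernoulli_iff:
  assumes p: "prime p" and o: "odd p" and m: "m > 0"
    and k: "of_int k = of_nat m * (2 ^ m - 1) * bernoulli m"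
  shows "(\<exists>v \<in> local_int p. (1 - 2 ^ m) * bernoulli m = of_nat p * v) \<longleftrightarrow> int p dvd k"
proof -
  let ?x = "(1 - 2 ^ m) * bernoulli m"
  have kx: "of_int k = - of_nat m * ?x" unfolding k by (simp add: algebra_simps)
  have "(\<exists>v \<in> local_int p. ?x = of_nat p * v) \<longleftrightarrow> (\<exists>v \<in> local_int p. of_int k = of_nat p * v)"
  proof (intro iffI; elim bexE)
    fix v assume v: "v \<in> local_int p" "?x = of_nat p * v"
    then have "- (of_nat m * v) \<in> local_int p"
      using p by (intro local_int_uminus local_int_mult local_int_basic)
    then show "\<exists>v \<in> local_int p. of_int k = of_nat p * v"
      unfolding kx v(2) by (rule bexI[rotated]) simp
  next
    fix v assume v: "v \<in> local_int p" "of_int k = of_nat p * v"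
    show "\<exists>v \<in> local_int p. ?x = of_nat p * v"
    proof (cases "p dvd m")
      case True
      then obtain c where c: "m = p * c" by auto
      have "of_nat c * (1/2 * euler_number (m - 1)) \<in> local_int p"
        using p o by (intro local_int_mult local_int_basic half_local_int euler_number_local_int)
      moreover have "?x = of_nat p * (of_nat c * (1/2 * euler_number (m - 1)))"
        unfolding euler_number_bernoulli[OF m, symmetric] by (simp add: c)
      ultimately show ?thesis by blast
    next
      case False
      then have "1 / of_nat m \<in> local_int p" using local_intI[of p "int m" 1] by simp
      then have "- v * (1 / of_nat m) \<in> local_int p"
        using v p by (intro local_int_mult local_int_uminus)
      moreover have "of_nat p * (- v * (1 / of_nat m)) = - of_int k / of_nat m"
        unfolding v(2) by simp
      then have "?x = of_nat p * (- v * (1 / of_nat m))" using m unfolding kx by simp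
      ultimately show ?thesis by blast
    qed
  qed
  then show ?thesis using prime_multiple_local_int_iff_dvd[OF p] by blast
qed

theorem theorem1:
  fixes m p :: nat
  assumes "even m" and "m > 0" and "prime p" and "odd p"
  shows "\<exists>k :: int. of_int k = of_nat m * (2 ^ m - 1) * bernoulli m \<and>
           (eisenstein_form p (euler_poly (m * p) (m * p)) \<longleftrightarrow> \<not> int p dvd k)"
proof -
  let ?x = "(1 - 2 ^ m) * bernoulli m"
  have p: "prime p" "odd p" "m * p > 0" using assms by (auto simp: prime_gt_0_nat)
  have "m > 1" using assms(1,2) by (cases "m = 1") auto
  obtain k where k: "of_int k = of_nat m * (2 ^ m - 1) * bernoulli m"
    using even_index_bernoulli_multiple_integral[OF assms(1,2)] by (auto elim: Ints_cases)
  obtain w where w: "w \<in> local_int p"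
      "higher_euler_number (m * p) (m * p) = of_nat p * (?x + of_nat p * w)"
    using higher_euler_number_bernoulli[OF p(1,2) \<open>m > 1\<close>] by blast
  have "of_nat m * (1/2) * euler_number (m - 1) \<in> local_int p"
    by (intro local_int_mult local_int_basic half_local_int euler_number_local_int p)
  then have "?x \<in> local_int p"
    unfolding euler_number_bernoulli[OF assms(2), symmetric] by simp
  then have "?x + of_nat p * w \<in> local_int p"
    by (rule local_int_add[OF p(1) _ local_int_mult[OF p(1) local_int_basic(3)[OF p(1)] w(1)]])
  from padic_val_prime_multiple(2)[OF p(1) this]
  have "eisenstein_form p (euler_poly (m * p) (m * p)) \<longleftrightarrow> \<not> int p dvd k"
    unfolding eisenstein_form_euler_poly_iff[OF p] w(2) prime_multiple_add_iff[OF p(1) w(1)]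
      prime_multiple_bernoulli_iff[OF p(1,2) assms(2) k] .
  then show ?thesis using k by blast
qed

end
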